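(* Let $K$ be a strongly connected simplicial complex. The group of projectivities $\Pi(\widetilde{K})$ of the complete unfolding $\widetilde{K}$ of $K$ is trivial.
   Context: $K$ is a locally finite simplicial complex, pure of dimension $d$ (every face lies in a $d$-dimensional face). $d$-dimensional faces are facets, codimension-$1$ faces are ridges; two distinct facets are neighbors if they share a ridge; $V(\sigma)$ is the vertex set of $\sigma$. $K$ is strongly connected if any two facets are joined by a facet path, i.e. a sequence of facets with consecutive ones neighbors. For neighboring facets $\sigma,\tau$ the perspectivity $\langle\sigma,\tau\rangle:V(\sigma)\to V(\tau)$ is the bijection fixing all common vertices and sending the vertex of $\sigma$ not in $\tau$ to the vertex of $\tau$ not in $\sigma$. For a facet path $\gamma=(\sigma_0,\dots,\sigma_n)$ put $\langle\gamma\rangle=\langle\sigma_0,\sigma_1\rangle\cdots\langle\sigma_{n-1},\sigma_n\rangle$ (maps composed left to right), the projectivity along $\gamma$, and $\gamma^-=(\sigma_n,\dots,\sigma_0)$. The projectivities along closed facet paths based at $\sigma_0$ form the group of projectivities $\Pi(K,\sigma_0)\le\operatorname{Sym}(V(\sigma_0))$; for strongly connected $K$ it is, up to conjugation in $S_{d+1}$, independent of $\sigma_0$ and denoted $\Pi(K)$. A pseudo-simplicial complex is a quotient of a disjoint union of geometric simplices by identifications given by simplicial isomorphisms between subcomplexes of pairs of the simplices, such that the quotient map is injective on each simplex. Facet paths, perspectivities, projectivities and the group of projectivities are defined for pseudo-simplicial complexes in the same way, except that in a facet path one also specifies the common ridges through which one passes between consecutive facets (the perspectivity through a ridge fixes the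 vertices of that ridge). Complete unfolding. Fix a facet $\sigma_0$ and a bijective coloring $b_0:V(\sigma_0)\to\{0,\dots,d\}$. A coloring of $V(\sigma)$, $\sigma$ a facet, is admissible if it has the form $\langle\eta^-\rangle b_0$ for some facet path $\eta$ from $\sigma_0$ to $\sigma$. Take a copy $(\sigma,b)$ of the simplex $\sigma$ for each facet $\sigma$ and each admissible coloring $b$ of $V(\sigma)$; for neighbors $\sigma,\tau$ glue $(\sigma,b)$ and $(\tau,c)$ by the identity along the common ridge $\rho$ whenever $b$ and $c$ coincide on the vertices of $\rho$. The quotient of the disjoint union by the generated equivalence relation is the pseudo-simplicial complex $\widetilde{K}$ (independent, up to isomorphism, of the choices). *)

theory Defs
  imports Complex_Main "HOL-Algebra.Elementary_Groups"
begin

section \<open>Simplicial complexes\<close>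

text \<open>The empty set counts as the face of dimension -1; in particular it is a ridge when
  d = 0, so that any two vertices of a 0-dimensional complex are neighbors.\<close>

definition abs_complex :: "'a set set \<Rightarrow> bool" where
  "abs_complex K \<longleftrightarrow> (\<forall>\<sigma>\<in>K. finite \<sigma> \<and> (\<forall>\<tau>. \<tau> \<subseteq> \<sigma> \<longrightarrow> \<tau> \<in> K))"

definition locally_finite_complex :: "'a set set \<Rightarrow> bool" where
  "locally_finite_complex K \<longleftrightarrow> (\<forall>v. finite {\<sigma>\<in>K. v \<in> \<sigma>})"

definition facets :: "nat \<Rightarrow> 'a set set \<Rightarrow> 'a set set" where
  "facets d K = {\<sigma>\<in>K. card \<sigma> = d + 1}"

definition ridges :: "nat \<Rightarrow> 'a set set \<Rightarrow> 'a set set" where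
  "ridges d K = {\<rho>\<in>K. card \<rho> = d}"

definition pure_complex :: "nat \<Rightarrow> 'a set set \<Rightarrow> bool" where
  "pure_complex d K \<longleftrightarrow> (\<forall>\<sigma>\<in>K. \<exists>\<tau>\<in>facets d K. \<sigma> \<subseteq> \<tau>)"

definition neighbors :: "nat \<Rightarrow> 'a set set \<Rightarrow> 'a set \<Rightarrow> 'a set \<Rightarrow> bool" where
  "neighbors d K \<sigma> \<tau> \<longleftrightarrow>
     \<sigma> \<in> facets d K \<and> \<tau> \<in> facets d K \<and> \<sigma> \<noteq> \<tau> \<and> \<sigma> \<inter> \<tau> \<in> ridges d K"

definition facet_path :: "nat \<Rightarrow> 'a set set \<Rightarrow> 'a set list \<Rightarrow> bool" where
  "facet_path d K \<gamma> \<longleftrightarrow> \<gamma> \<noteq> [] \<and> set \<gamma> \<subseteq> facets d K \<and> successively (neighbors d K) \<gamma>"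

definition strongly_connected :: "nat \<Rightarrow> 'a set set \<Rightarrow> bool" where
  "strongly_connected d K \<longleftrightarrow>
     (\<forall>\<sigma>\<in>facets d K. \<forall>\<tau>\<in>facets d K. \<exists>\<gamma>. facet_path d K \<gamma> \<and> hd \<gamma> = \<sigma> \<and> last \<gamma> = \<tau>)"

text \<open>The perspectivity between facets with vertex sets S and T through a ridge with vertex
  set R. The ridge is a parameter because two facets of a pseudo-simplicial complex may share
  several ridges; in a simplicial complex it is \<open>S \<inter> T\<close>. Maps between vertex sets are
  extensional, so that equality of maps is equality on the vertex set.\<close>

definition perspectivity :: "'v set \<Rightarrow> 'v set \<Rightarrow> 'v set \<Rightarrow> 'v \<Rightarrow> 'v" where
  "perspectivity S R T = (\<lambda>v\<in>S. if v \<in> R then v else (THE w. w \<in> T - R))"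

fun projectivity :: "'a set list \<Rightarrow> 'a \<Rightarrow> 'a" where
  "projectivity [] = undefined"
| "projectivity [\<sigma>] = (\<lambda>v\<in>\<sigma>. v)"
| "projectivity (\<sigma> # \<tau> # \<gamma>) =
     compose \<sigma> (projectivity (\<tau> # \<gamma>)) (perspectivity \<sigma> (\<sigma> \<inter> \<tau>) \<tau>)"

section \<open>Pseudo-simplicial complexes\<close>

text \<open>The geometric simplex spanned by a finite set of vertices, in barycentric coordinates.\<close>

definition geom_simplex :: "'v set \<Rightarrow> ('v \<Rightarrow> real) set" where
  "geom_simplex V = {x. (\<forall>v. 0 \<le> x v) \<and> (\<forall>v. v \<notin> V \<longrightarrow> x v = 0) \<and> sum x V = 1}"

definition vertex_pt :: "'v \<Rightarrow> 'v \<Rightarrow> real" where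
  "vertex_pt v = (\<lambda>w. if w = v then 1 else 0)"

text \<open>A family of simplices indexed by \<open>cells\<close>, where cell \<open>i\<close> has vertex set \<open>cverts i\<close>,
  together with identifications: \<open>(i, L, \<phi>, j)\<close> glues the subcomplex \<open>L\<close> of the simplex \<open>i\<close> to
  a subcomplex of the simplex \<open>j\<close> by the simplicial isomorphism with vertex map \<open>\<phi>\<close>.\<close>

record ('i, 'v) gluing =
  cells :: "'i set"
  cverts :: "'i \<Rightarrow> 'v set"
  idents :: "('i \<times> 'v set set \<times> ('v \<Rightarrow> 'v) \<times> 'i) set"

definition glue_step :: "('i, 'v) gluing \<Rightarrow> (('i \<times> ('v \<Rightarrow> real)) \<times> ('i \<times> ('v \<Rightarrow> real))) set" where
  "glue_step P = {((i, x), (j, y)) | i x j y. \<exists>L \<phi> F. (i, L, \<phi>, j) \<in> idents P \<and> F \<in> L \<and>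
     x \<in> geom_simplex F \<and> y \<in> geom_simplex (\<phi> ` F) \<and> (\<forall>v\<in>F. y (\<phi> v) = x v)}"

definition glue_equiv :: "('i, 'v) gluing \<Rightarrow> (('i \<times> ('v \<Rightarrow> real)) \<times> ('i \<times> ('v \<Rightarrow> real))) set" where
  "glue_equiv P = (glue_step P \<union> (glue_step P)\<inverse>)\<^sup>*"

definition quot_map :: "('i, 'v) gluing \<Rightarrow> 'i \<Rightarrow> ('v \<Rightarrow> real) \<Rightarrow> ('i \<times> ('v \<Rightarrow> real)) set" where
  "quot_map P i x = glue_equiv P `` {(i, x)}"

definition pseudo_complex :: "('i, 'v) gluing \<Rightarrow> bool" where
  "pseudo_complex P \<longleftrightarrow>
     (\<forall>i\<in>cells P. finite (cverts P i) \<and> cverts P i \<noteq> {}) \<and>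
     (\<forall>(i, L, \<phi>, j)\<in>idents P. i \<in> cells P \<and> j \<in> cells P \<and>
        L \<subseteq> Pow (cverts P i) \<and> (\<forall>F\<in>L. \<forall>G. G \<subseteq> F \<longrightarrow> G \<in> L) \<and>
        inj_on \<phi> (\<Union>L) \<and> (\<forall>F\<in>L. \<phi> ` F \<subseteq> cverts P j)) \<and>
     (\<forall>i\<in>cells P. inj_on (quot_map P i) (geom_simplex (cverts P i)))"

text \<open>Faces are point sets in the quotient: the images of the faces of the simplices.
  \<open>pfaces P k\<close> consists of the faces of dimension k - 1.\<close>

type_synonym ('i, 'v) point = "('i \<times> ('v \<Rightarrow> real)) set"

definition pfaces :: "('i, 'v) gluing \<Rightarrow> nat \<Rightarrow> ('i, 'v) point set set" where
  "pfaces P k = {quot_map P i ` geom_simplex F | i F. i \<in> cells P \<and> F \<subseteq> cverts P i \<and> card F = k}"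

definition pverts :: "('i, 'v) gluing \<Rightarrow> ('i, 'v) point set \<Rightarrow> ('i, 'v) point set" where
  "pverts P A = A \<inter> {quot_map P i (vertex_pt v) | i v. i \<in> cells P \<and> v \<in> cverts P i}"

definition pfacets :: "nat \<Rightarrow> ('i, 'v) gluing \<Rightarrow> ('i, 'v) point set set" where
  "pfacets d P = pfaces P (d + 1)"

definition pridges :: "nat \<Rightarrow> ('i, 'v) gluing \<Rightarrow> ('i, 'v) point set set" where
  "pridges d P = pfaces P d"

text \<open>A facet path is given by its first facet and the list of pairs consisting of the ridge
  passed through and the next facet; \<open>pfacet_path d P \<Sigma> \<gamma> T\<close> says that it leads from \<open>\<Sigma>\<close> to \<open>T\<close>.\<close>

fun pfacet_path :: "nat \<Rightarrow> ('i, 'v) gluing \<Rightarrow> ('i, 'v) point set \<Rightarrow>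
    (('i, 'v) point set \<times> ('i, 'v) point set) list \<Rightarrow> ('i, 'v) point set \<Rightarrow> bool" where
  "pfacet_path d P \<Sigma> [] T \<longleftrightarrow> \<Sigma> \<in> pfacets d P \<and> T = \<Sigma>"
| "pfacet_path d P \<Sigma> ((R, \<Sigma>') # \<gamma>) T \<longleftrightarrow>
     \<Sigma> \<in> pfacets d P \<and> \<Sigma>' \<in> pfacets d P \<and> \<Sigma> \<noteq> \<Sigma>' \<and>
     R \<in> pridges d P \<and> R \<subseteq> \<Sigma> \<and> R \<subseteq> \<Sigma>' \<and> pfacet_path d P \<Sigma>' \<gamma> T"

fun pprojectivity :: "('i, 'v) gluing \<Rightarrow> ('i, 'v) point set \<Rightarrow>
    (('i, 'v) point set \<times> ('i, 'v) point set) list \<Rightarrow> ('i, 'v) point \<Rightarrow> ('i, 'v) point" where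
  "pprojectivity P \<Sigma> [] = (\<lambda>p\<in>pverts P \<Sigma>. p)"
| "pprojectivity P \<Sigma> ((R, \<Sigma>') # \<gamma>) = compose (pverts P \<Sigma>) (pprojectivity P \<Sigma>' \<gamma>)
     (perspectivity (pverts P \<Sigma>) (pverts P R) (pverts P \<Sigma>'))"

text \<open>Maps are composed from left to right.\<close>

definition proj_group :: "nat \<Rightarrow> ('i, 'v) gluing \<Rightarrow> ('i, 'v) point set \<Rightarrow>
    (('i, 'v) point \<Rightarrow> ('i, 'v) point) monoid" where
  "proj_group d P \<Sigma> =
     \<lparr>carrier = {pprojectivity P \<Sigma> \<gamma> | \<gamma>. pfacet_path d P \<Sigma> \<gamma> \<Sigma>},
      mult = (\<lambda>f g. compose (pverts P \<Sigma>) g f),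
      one = (\<lambda>p\<in>pverts P \<Sigma>. p)\<rparr>"

section \<open>The complete unfolding\<close>

definition admissible ::
    "nat \<Rightarrow> 'a set set \<Rightarrow> 'a set \<Rightarrow> ('a \<Rightarrow> nat) \<Rightarrow> 'a set \<Rightarrow> ('a \<Rightarrow> nat) \<Rightarrow> bool" where
  "admissible d K \<sigma>\<^sub>0 b\<^sub>0 \<sigma> b \<longleftrightarrow>
     (\<exists>\<eta>. facet_path d K \<eta> \<and> hd \<eta> = \<sigma>\<^sub>0 \<and> last \<eta> = \<sigma> \<and> b = compose \<sigma> b\<^sub>0 (projectivity (rev \<eta>)))"

definition unfolding_cells ::
    "nat \<Rightarrow> 'a set set \<Rightarrow> 'a set \<Rightarrow> ('a \<Rightarrow> nat) \<Rightarrow> ('a set \<times> ('a \<Rightarrow> nat)) set" where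
  "unfolding_cells d K \<sigma>\<^sub>0 b\<^sub>0 = {(\<sigma>, b). \<sigma> \<in> facets d K \<and> admissible d K \<sigma>\<^sub>0 b\<^sub>0 \<sigma> b}"

definition complete_unfolding ::
    "nat \<Rightarrow> 'a set set \<Rightarrow> 'a set \<Rightarrow> ('a \<Rightarrow> nat) \<Rightarrow> ('a set \<times> ('a \<Rightarrow> nat), 'a) gluing" where
  "complete_unfolding d K \<sigma>\<^sub>0 b\<^sub>0 =
     \<lparr>cells = unfolding_cells d K \<sigma>\<^sub>0 b\<^sub>0,
      cverts = fst,
      idents = {((\<sigma>, b), Pow (\<sigma> \<inter> \<tau>), id, (\<tau>, c)) | \<sigma> b \<tau> c.
        (\<sigma>, b) \<in> unfolding_cells d K \<sigma>\<^sub>0 b\<^sub>0 \<and> (\<tau>, c) \<in> unfolding_cells d K \<sigma>\<^sub>0 b\<^sub>0 \<and>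
        neighbors d K \<sigma> \<tau> \<and> (\<forall>v\<in>\<sigma> \<inter> \<tau>. b v = c v)}\<rparr>"

lemma perspectivity_bij:
  assumes fin: "finite \<sigma>" "finite \<tau>"
    and card: "card \<sigma> = d + 1" "card \<tau> = d + 1" "card (\<sigma> \<inter> \<tau>) = d"
  shows "bij_betw (perspectivity \<sigma> (\<sigma> \<inter> \<tau>) \<tau>) \<sigma> \<tau>"
proof -
  have "card (\<sigma> - \<sigma> \<inter> \<tau>) = 1" "card (\<tau> - \<sigma> \<inter> \<tau>) = 1"
    using assms by (simp_all add: card_Diff_subset)
  then obtain v w where v: "\<sigma> - \<sigma> \<inter> \<tau> = {v}" and w: "\<tau> - \<sigma> \<inter> \<tau> = {w}"
    by (meson card_1_singletonE)
  have the: "(THE w. w \<in> \<tau> - \<sigma> \<inter> \<tau>) = w"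
    unfolding w by simp
  define \<rho> where "\<rho> = \<sigma> \<inter> \<tau>"
  have \<sigma>: "\<sigma> = insert v \<rho>" "v \<notin> \<rho>" and \<tau>: "\<tau> = insert w \<rho>" "w \<notin> \<rho>"
    using v w unfolding \<rho>_def by blast+
  have eq: "perspectivity \<sigma> (\<sigma> \<inter> \<tau>) \<tau> = (\<lambda>u\<in>\<sigma>. if u \<in> \<rho> then u else w)"
    unfolding perspectivity_def the \<rho>_def ..
  show ?thesis
    unfolding eq bij_betw_def inj_on_def using \<sigma> \<tau>(2) unfolding \<tau>(1) by (simp add: image_def)
qed

lemma projectivity_bij:
  assumes "abs_complex K" "facet_path d K \<gamma>"
  shows "bij_betw (projectivity \<gamma>) (hd \<gamma>) (last \<gamma>)"
  using assms(2)
proof (induction \<gamma> rule: projectivity.induct)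
  case 1
  then show ?case by (simp add: facet_path_def)
next
  case (2 \<sigma>)
  then show ?case by (simp add: bij_betw_def inj_on_def)
next
  case (3 \<sigma> \<tau> \<gamma>)
  then have nb: "neighbors d K \<sigma> \<tau>" and path: "facet_path d K (\<tau> # \<gamma>)"
    by (auto simp: facet_path_def)
  have "bij_betw (perspectivity \<sigma> (\<sigma> \<inter> \<tau>) \<tau>) \<sigma> \<tau>"
    using nb assms(1)
    by (intro perspectivity_bij[of _ _ d])
       (auto simp: neighbors_def facets_def ridges_def abs_complex_def)
  moreover have "bij_betw (projectivity (\<tau> # \<gamma>)) \<tau> (last (\<tau> # \<gamma>))"
    using 3(1)[OF path] by simp
  ultimately show ?case
    by (simp add: bij_betw_compose)
qed

lemma facet_path_rev: "facet_path d K \<gamma> \<Longrightarrow> facet_path d K (rev \<gamma>)"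
  by (auto simp: facet_path_def neighbors_def Int_commute intro: successively_mono)

lemma admissible_bij:
  assumes "abs_complex K" "bij_betw b\<^sub>0 \<sigma>\<^sub>0 {0..d}" "admissible d K \<sigma>\<^sub>0 b\<^sub>0 \<sigma> b"
  shows "bij_betw b \<sigma> {0..d}"
proof -
  obtain \<eta> where \<eta>: "facet_path d K \<eta>" "hd \<eta> = \<sigma>\<^sub>0" "last \<eta> = \<sigma>"
    and b: "b = compose \<sigma> b\<^sub>0 (projectivity (rev \<eta>))"
    using assms(3) by (auto simp: admissible_def)
  have "bij_betw (projectivity (rev \<eta>)) \<sigma> \<sigma>\<^sub>0"
    using projectivity_bij[OF assms(1) facet_path_rev[OF \<eta>(1)]] \<eta>
    by (simp add: facet_path_def hd_rev last_rev)
  then show ?thesis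
    unfolding b using assms(2) by (rule bij_betw_compose)
qed

text \<open>The key invariant: identified points have the same barycentric coordinates when these
  are indexed by colors.\<close>

definition color_coord :: "('a set \<times> ('a \<Rightarrow> nat)) \<times> ('a \<Rightarrow> real) \<Rightarrow> nat \<Rightarrow> real" where
  "color_coord = (\<lambda>((\<sigma>, b), x) k. \<Sum>v | v \<in> \<sigma> \<and> b v = k. x v)"

lemma color_coord_step:
  assumes "abs_complex K" "(p, q) \<in> glue_step (complete_unfolding d K \<sigma>\<^sub>0 b\<^sub>0)"
  shows "color_coord p = color_coord q"
proof -
  obtain \<sigma> b x \<tau> c y F where pq: "p = ((\<sigma>, b), x)" "q = ((\<tau>, c), y)"
    and nb: "neighbors d K \<sigma> \<tau>" and bc: "\<forall>v\<in>\<sigma> \<inter> \<tau>. b v = c v" and F: "F \<subseteq> \<sigma> \<inter> \<tau>"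
    and x: "x \<in> geom_simplex F" and y: "y \<in> geom_simplex F" and xy: "\<forall>v\<in>F. y v = x v"
    using assms(2) by (auto simp: glue_step_def complete_unfolding_def)
  have fin: "finite \<sigma>" "finite \<tau>"
    using nb assms(1) by (auto simp: neighbors_def facets_def abs_complex_def)
  have "color_coord p k = color_coord q k" for k
  proof -
    have bF: "b v = c v" if "v \<in> F" for v
      using F bc that by blast
    have "(\<Sum>v | v \<in> \<sigma> \<and> b v = k. x v) = (\<Sum>v | v \<in> F \<and> b v = k. x v)"
      using fin F x by (intro sum.mono_neutral_right) (auto simp: geom_simplex_def)
    also have "\<dots> = (\<Sum>v | v \<in> F \<and> c v = k. y v)"
      using bF xy by (intro sum.cong) auto
    also have "\<dots> = (\<Sum>v | v \<in> \<tau> \<and> c v = k. y v)"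
      using fin F y by (intro sum.mono_neutral_left) (auto simp: geom_simplex_def)
    finally show ?thesis
      by (simp add: color_coord_def pq)
  qed
  then show ?thesis by blast
qed

lemma color_coord_equiv:
  assumes "abs_complex K" "(p, q) \<in> glue_equiv (complete_unfolding d K \<sigma>\<^sub>0 b\<^sub>0)"
  shows "color_coord p = color_coord q"
  using assms(2) unfolding glue_equiv_def
  by (induction rule: rtrancl_induct) (auto dest: color_coord_step[OF assms(1)])

lemma pseudo_complex_complete_unfolding:
  assumes K: "abs_complex K" and b\<^sub>0: "bij_betw b\<^sub>0 \<sigma>\<^sub>0 {0..d}"
  shows "pseudo_complex (complete_unfolding d K \<sigma>\<^sub>0 b\<^sub>0)"
proof -
  let ?P = "complete_unfolding d K \<sigma>\<^sub>0 b\<^sub>0"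
  have "x = y"
    if cell: "(\<sigma>, b) \<in> unfolding_cells d K \<sigma>\<^sub>0 b\<^sub>0" and x: "x \<in> geom_simplex \<sigma>"
      and y: "y \<in> geom_simplex \<sigma>" and eq: "quot_map ?P (\<sigma>, b) x = quot_map ?P (\<sigma>, b) y"
    for \<sigma> b x y
  proof
    fix v
    have "((\<sigma>, b), y) \<in> quot_map ?P (\<sigma>, b) y"
      by (simp add: quot_map_def glue_equiv_def)
    then have "(((\<sigma>, b), x), ((\<sigma>, b), y)) \<in> glue_equiv ?P"
      using eq by (auto simp: quot_map_def)
    from color_coord_equiv[OF K this]
    have sums: "(\<Sum>w | w \<in> \<sigma> \<and> b w = b v. x w) = (\<Sum>w | w \<in> \<sigma> \<and> b w = b v. y w)"
      by (auto simp: color_coord_def dest: fun_cong)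
    show "x v = y v"
    proof (cases "v \<in> \<sigma>")
      case True
      have "inj_on b \<sigma>"
        using admissible_bij[OF K b\<^sub>0] cell by (auto simp: unfolding_cells_def bij_betw_def)
      then have "{w. w \<in> \<sigma> \<and> b w = b v} = {v}"
        using True by (auto simp: inj_on_def)
      then show ?thesis using sums by simp
    next
      case False
      then show ?thesis using x y by (simp add: geom_simplex_def)
    qed
  qed
  then show ?thesis
    using K
    by (auto simp: pseudo_complex_def complete_unfolding_def inj_on_def unfolding_cells_def
        facets_def abs_complex_def)
qed

end

theory Submission
  imports Defs
begin

text \<open>The unfolding is built so that it can be colored. Two copies \<open>(\<sigma>, b)\<close> and \<open>(\<tau>, c)\<close> are
  glued only where b and c agree, so the colors of the copies descend to a coloring of the
  vertices of the quotient, which uses every color in \<open>{0..d}\<close> exactly once on each facet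
  (\<open>bij_betw_point_color\<close>). A perspectivity through a ridge fixes d vertices, hence their colors,
  and has to send the remaining vertex of one facet to the remaining vertex of the other; both
  carry the one color that is absent from the ridge (\<open>perspectivity_preserves_color\<close>). So every
  projectivity preserves colors, and along a closed path a vertex can only return to itself,
  because its color determines it within its facet.

  The one point that needs geometry is that a face of the quotient, being a set of points, has no
  vertices other than the images of the vertices of the simplex from which it comes. Barycentric
  coordinates indexed by colors are invariant under the gluing; a point identified with a vertex
  therefore has the coordinates of a vertex and is one.\<close>

section \<open>Colorings and perspectivities\<close>

text \<open>The color of the moved vertex is the element of C missed by the ridge, and the same
  holds for its image.\<close>

lemma perspectivity_preserves_color:
  assumes S: "bij_betw \<kappa> S C" and T: "bij_betw \<kappa> T C" and R: "R \<subseteq> S" "R \<subseteq> T"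
    and fin: "finite C" and card: "card C = Suc (card (\<kappa> ` R))" and v: "v \<in> S"
  shows "perspectivity S R T v \<in> T" "\<kappa> (perspectivity S R T v) = \<kappa> v"
proof -
  have "card (C - \<kappa> ` R) = 1"
    using card fin S R by (subst card_Diff_subset) (auto simp: bij_betw_def intro: finite_subset)
  then obtain k where k: "C - \<kappa> ` R = {k}"
    by (meson card_1_singletonE)
  have image_diff: "\<kappa> ` (A - R) = {k}" if "bij_betw \<kappa> A C" "R \<subseteq> A" for A
    using that k by (simp add: bij_betw_def inj_on_image_set_diff[of \<kappa> A A R])
  have color: "\<kappa> u = k" if "bij_betw \<kappa> A C" "R \<subseteq> A" "u \<in> A" "u \<notin> R" for A u
    using image_diff[OF that(1,2)] imageI[of u "A - R" \<kappa>] that(3,4) by simp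
  have inj: "inj_on \<kappa> (T - R)"
    using T by (auto simp: bij_betw_def intro: inj_on_diff)
  obtain w where w: "w \<in> T - R"
    using image_diff[OF T R(2)] by blast
  have "u = w" if "u \<in> T - R" for u
  proof (rule inj_onD[OF inj _ that w])
    show "\<kappa> u = \<kappa> w"
      using color[OF T R(2)] that w by simp
  qed
  then have the: "(THE u. u \<in> T - R) = w"
    using w by blast
  have "\<kappa> w = \<kappa> v" if "v \<notin> R"
    using color[OF T R(2)] color[OF S R(1)] w v that by simp
  then show "perspectivity S R T v \<in> T" "\<kappa> (perspectivity S R T v) = \<kappa> v"
    using v w R the by (auto simp: perspectivity_def)
qed

lemma pprojectivity_preserves_color:
  assumes facet: "\<And>\<Sigma>. \<Sigma> \<in> pfacets d P \<Longrightarrow> bij_betw \<kappa> (pverts P \<Sigma>) {0..d}"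
    and ridge: "\<And>R. R \<in> pridges d P \<Longrightarrow> card (\<kappa> ` pverts P R) = d"
    and "pfacet_path d P \<Sigma> \<gamma> T" "p \<in> pverts P \<Sigma>"
  shows "pprojectivity P \<Sigma> \<gamma> p \<in> pverts P T \<and> \<kappa> (pprojectivity P \<Sigma> \<gamma> p) = \<kappa> p"
  using assms(3,4)
proof (induction \<gamma> arbitrary: \<Sigma> p)
  case Nil
  then show ?case by simp
next
  case (Cons e \<gamma>)
  obtain R \<Sigma>' where e: "e = (R, \<Sigma>')"
    by (cases e)
  have path: "\<Sigma> \<in> pfacets d P" "\<Sigma>' \<in> pfacets d P" "R \<in> pridges d P" "R \<subseteq> \<Sigma>" "R \<subseteq> \<Sigma>'"
    "pfacet_path d P \<Sigma>' \<gamma> T"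
    using Cons.prems(1) by (auto simp: e)
  let ?q = "perspectivity (pverts P \<Sigma>) (pverts P R) (pverts P \<Sigma>') p"
  have sub: "pverts P R \<subseteq> pverts P \<Sigma>" "pverts P R \<subseteq> pverts P \<Sigma>'"
    using path by (auto simp: pverts_def)
  have "?q \<in> pverts P \<Sigma>'" "\<kappa> ?q = \<kappa> p"
    using perspectivity_preserves_color[OF facet[OF path(1)] facet[OF path(2)] sub _ _ Cons.prems(2)]
      ridge[OF path(3)]
    by simp_all
  then show ?case
    using Cons.IH[OF path(6), of ?q] Cons.prems(2) by (simp add: e compose_def)
qed

text \<open>Such a coloring is injective on each facet, so a color-preserving map of the vertices of a
  facet to themselves is the identity.\<close>

lemma trivial_proj_group_if_colored:
  assumes facet: "\<And>\<Sigma>. \<Sigma> \<in> pfacets d P \<Longrightarrow> bij_betw \<kappa> (pverts P \<Sigma>) {0..d}"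
    and ridge: "\<And>R. R \<in> pridges d P \<Longrightarrow> card (\<kappa> ` pverts P R) = d"
    and \<Sigma>: "\<Sigma> \<in> pfacets d P"
  shows "trivial_group (proj_group d P \<Sigma>)"
proof -
  let ?G = "proj_group d P \<Sigma>"
  have "pprojectivity P \<Sigma> \<gamma> = (\<lambda>p\<in>pverts P \<Sigma>. p)" if path: "pfacet_path d P \<Sigma> \<gamma> \<Sigma>" for \<gamma>
  proof (rule extensionalityI)
    show "pprojectivity P \<Sigma> \<gamma> \<in> extensional (pverts P \<Sigma>)"
      by (cases "(P, \<Sigma>, \<gamma>)" rule: pprojectivity.cases) simp_all
    show "(\<lambda>p\<in>pverts P \<Sigma>. p) \<in> extensional (pverts P \<Sigma>)"
      by simp
    fix p assume p: "p \<in> pverts P \<Sigma>"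
    show "pprojectivity P \<Sigma> \<gamma> p = (\<lambda>p\<in>pverts P \<Sigma>. p) p"
      using pprojectivity_preserves_color[OF facet ridge path p] facet[OF \<Sigma>] p
      by (auto simp: bij_betw_def inj_on_def)
  qed
  moreover have "pfacet_path d P \<Sigma> [] \<Sigma>"
    using \<Sigma> by simp
  ultimately have carrier: "carrier ?G = {\<one>\<^bsub>?G\<^esub>}"
    unfolding proj_group_def by (auto intro!: exI[of _ "[]"])
  have "\<one>\<^bsub>?G\<^esub> \<otimes>\<^bsub>?G\<^esub> \<one>\<^bsub>?G\<^esub> = \<one>\<^bsub>?G\<^esub>"
    by (simp add: proj_group_def compose_def restrict_def fun_eq_iff)
  then have "group ?G"
    by (intro groupI) (auto simp: carrier)
  then show ?thesis
    using carrier by (simp add: trivial_group_def)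
qed

section \<open>The vertex coloring of the complete unfolding\<close>

text \<open>Every point identified with a vertex of color k has coordinates, indexed by colors, that are
  1 at k and 0 elsewhere; so k can be read off from any representative.\<close>

definition point_color :: "('a set \<times> ('a \<Rightarrow> nat), 'a) point \<Rightarrow> nat" where
  "point_color p = (THE k. \<exists>q\<in>p. color_coord q k = 1)"

lemma color_coord_at_vertex:
  assumes "inj_on b \<sigma>" "v \<in> \<sigma>"
  shows "color_coord ((\<sigma>, b), x) (b v) = x v"
proof -
  have "{w. w \<in> \<sigma> \<and> b w = b v} = {v}"
    using assms by (auto simp: inj_on_def)
  then show ?thesis
    by (simp add: color_coord_def)
qed

lemma color_coord_vertex_pt:
  assumes "inj_on b \<sigma>" "v \<in> \<sigma>"
  shows "color_coord ((\<sigma>, b), vertex_pt v) k = (if k = b v then 1 else 0)"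
proof (cases "k = b v")
  case True
  then show ?thesis
    using color_coord_at_vertex[OF assms] by (simp add: vertex_pt_def)
next
  case False
  then show ?thesis
    by (auto simp: color_coord_def vertex_pt_def intro!: sum.neutral)
qed

lemma mem_quot_map_self: "(i, x) \<in> quot_map P i x"
  by (simp add: quot_map_def glue_equiv_def)

lemma color_coord_quot_map:
  assumes "abs_complex K" "q \<in> quot_map (complete_unfolding d K \<sigma>\<^sub>0 b\<^sub>0) i x"
  shows "color_coord q = color_coord (i, x)"
  using color_coord_equiv[OF assms(1)] assms(2) by (fastforce simp: quot_map_def)

lemma point_color_vertex:
  assumes "abs_complex K" "inj_on b \<sigma>" "v \<in> \<sigma>"
  shows "point_color (quot_map (complete_unfolding d K \<sigma>\<^sub>0 b\<^sub>0) (\<sigma>, b) (vertex_pt v)) = b v"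
  unfolding point_color_def
proof (rule the_equality)
  let ?p = "quot_map (complete_unfolding d K \<sigma>\<^sub>0 b\<^sub>0) (\<sigma>, b) (vertex_pt v)"
  show "\<exists>q\<in>?p. color_coord q (b v) = 1"
    using mem_quot_map_self color_coord_vertex_pt[OF assms(2,3), of "b v"] by force
  show "k = b v" if "\<exists>q\<in>?p. color_coord q k = 1" for k
    using that color_coord_quot_map[OF assms(1)] color_coord_vertex_pt[OF assms(2,3), of k]
    by (metis zero_neq_one)
qed

lemma unfolding_cell:
  assumes "abs_complex K" "bij_betw b\<^sub>0 \<sigma>\<^sub>0 {0..d}" "(\<sigma>, b) \<in> unfolding_cells d K \<sigma>\<^sub>0 b\<^sub>0"
  shows "finite \<sigma>" "card \<sigma> = d + 1" "bij_betw b \<sigma> {0..d}"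
  using assms admissible_bij[OF assms(1,2)]
  by (auto simp: unfolding_cells_def facets_def abs_complex_def)

lemma vertex_pt_in_geom_simplex:
  assumes "finite F" "v \<in> F"
  shows "vertex_pt v \<in> geom_simplex F"
  using assms by (auto simp: geom_simplex_def vertex_pt_def)

text \<open>Since b is injective, the color coordinates are the barycentric coordinates up to
  renaming. They sum to 1, so they cannot all vanish, and k is the color of a vertex of F.\<close>

lemma vertex_pt_if_color_coord_indicator:
  assumes b: "inj_on b \<sigma>" and F: "F \<subseteq> \<sigma>" and x: "x \<in> geom_simplex F"
    and ind: "\<And>j. color_coord ((\<sigma>, b), x) j = (if j = k then 1 else 0)"
  shows "\<exists>v\<in>F. x = vertex_pt v"
proof -
  have coord: "x v = (if b v = k then 1 else 0)" if "v \<in> F" for v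
    using color_coord_at_vertex[OF b, of v x] ind[of "b v"] F that by auto
  have "sum x F \<noteq> 0"
    using x by (simp add: geom_simplex_def)
  then obtain v where v: "v \<in> F" "x v \<noteq> 0"
    by (meson sum.neutral)
  then have "b v = k"
    using coord by metis
  have "x w = vertex_pt v w" for w
  proof (cases "w \<in> F")
    case True
    then have "b w = b v \<longleftrightarrow> w = v"
      using b F v by (auto dest: inj_onD)
    then show ?thesis
      using coord[OF True] \<open>b v = k\<close> by (simp add: vertex_pt_def)
  next
    case False
    then show ?thesis
      using x v by (auto simp: geom_simplex_def vertex_pt_def)
  qed
  then show ?thesis
    using v by blast
qed

text \<open>A vertex of the quotient that lies on the image of the face F may be given by a vertex w of
  another copy; the point of F identified with w has the color coordinates of w, so it is a vertex
  of F.\<close>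

lemma pverts_complete_unfolding:
  fixes K :: "'a set set" and d \<sigma>\<^sub>0 b\<^sub>0
  defines "P \<equiv> complete_unfolding d K \<sigma>\<^sub>0 b\<^sub>0"
  assumes K: "abs_complex K" and b\<^sub>0: "bij_betw b\<^sub>0 \<sigma>\<^sub>0 {0..d}"
    and cell: "(\<sigma>, b) \<in> unfolding_cells d K \<sigma>\<^sub>0 b\<^sub>0" and F: "F \<subseteq> \<sigma>"
  shows "pverts P (quot_map P (\<sigma>, b) ` geom_simplex F) = (\<lambda>v. quot_map P (\<sigma>, b) (vertex_pt v)) ` F"
proof (intro equalityI subsetI)
  have inj: "inj_on c \<tau>" if "(\<tau>, c) \<in> unfolding_cells d K \<sigma>\<^sub>0 b\<^sub>0" for \<tau> c
    using unfolding_cell(3)[OF K b\<^sub>0 that] by (rule bij_betw_imp_inj_on)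
  have verts: "pverts P A = A \<inter> {quot_map P (\<tau>, c) (vertex_pt w) | \<tau> c w.
      (\<tau>, c) \<in> unfolding_cells d K \<sigma>\<^sub>0 b\<^sub>0 \<and> w \<in> \<tau>}" for A
    by (simp add: pverts_def P_def complete_unfolding_def)
  show "p \<in> (\<lambda>v. quot_map P (\<sigma>, b) (vertex_pt v)) ` F"
    if p: "p \<in> pverts P (quot_map P (\<sigma>, b) ` geom_simplex F)" for p
  proof -
    from p obtain x \<tau> c w where x: "x \<in> geom_simplex F" "p = quot_map P (\<sigma>, b) x"
      and \<tau>: "(\<tau>, c) \<in> unfolding_cells d K \<sigma>\<^sub>0 b\<^sub>0" "w \<in> \<tau>" "p = quot_map P (\<tau>, c) (vertex_pt w)"
      unfolding verts by blast
    have "((\<sigma>, b), x) \<in> quot_map P (\<tau>, c) (vertex_pt w)"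
      using mem_quot_map_self[of "(\<sigma>, b)" x P] x(2) \<tau>(3) by metis
    then have "color_coord ((\<sigma>, b), x) = color_coord ((\<tau>, c), vertex_pt w)"
      unfolding P_def by (rule color_coord_quot_map[OF K])
    then have "\<exists>v\<in>F. x = vertex_pt v"
      using vertex_pt_if_color_coord_indicator[OF inj[OF cell] F x(1), of "c w"]
        color_coord_vertex_pt[OF inj[OF \<tau>(1)] \<tau>(2)] by simp
    then show ?thesis
      using x(2) by blast
  qed
  show "p \<in> pverts P (quot_map P (\<sigma>, b) ` geom_simplex F)"
    if "p \<in> (\<lambda>v. quot_map P (\<sigma>, b) (vertex_pt v)) ` F" for p
  proof -
    from that obtain v where v: "v \<in> F" "p = quot_map P (\<sigma>, b) (vertex_pt v)"
      by blast
    have "vertex_pt v \<in> geom_simplex F"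
      using vertex_pt_in_geom_simplex[OF finite_subset[OF F unfolding_cell(1)[OF K b\<^sub>0 cell]] v(1)] .
    then show ?thesis
      unfolding verts using v F cell by blast
  qed
qed

lemma bij_betw_point_color:
  fixes K :: "'a set set" and d \<sigma>\<^sub>0 b\<^sub>0
  defines "P \<equiv> complete_unfolding d K \<sigma>\<^sub>0 b\<^sub>0"
  assumes K: "abs_complex K" and b\<^sub>0: "bij_betw b\<^sub>0 \<sigma>\<^sub>0 {0..d}"
    and cell: "(\<sigma>, b) \<in> unfolding_cells d K \<sigma>\<^sub>0 b\<^sub>0" and F: "F \<subseteq> \<sigma>"
  shows "bij_betw point_color (pverts P (quot_map P (\<sigma>, b) ` geom_simplex F)) (b ` F)"
proof -
  have inj: "inj_on b \<sigma>"
    using unfolding_cell(3)[OF K b\<^sub>0 cell] by (rule bij_betw_imp_inj_on)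
  have color: "point_color (quot_map P (\<sigma>, b) (vertex_pt v)) = b v" if "v \<in> F" for v
    using point_color_vertex[OF K inj] F that unfolding P_def by blast
  have "inj_on b F"
    using inj F by (rule inj_on_subset)
  then show ?thesis
    unfolding P_def pverts_complete_unfolding[OF K b\<^sub>0 cell F]
    using color unfolding P_def by (auto simp: bij_betw_def inj_on_def image_image)
qed

lemma pfaces_complete_unfoldingE:
  assumes "A \<in> pfaces (complete_unfolding d K \<sigma>\<^sub>0 b\<^sub>0) k"
  obtains \<sigma> b F where "(\<sigma>, b) \<in> unfolding_cells d K \<sigma>\<^sub>0 b\<^sub>0" "F \<subseteq> \<sigma>" "card F = k"
    "A = quot_map (complete_unfolding d K \<sigma>\<^sub>0 b\<^sub>0) (\<sigma>, b) ` geom_simplex F"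
proof -
  obtain i F where "i \<in> cells (complete_unfolding d K \<sigma>\<^sub>0 b\<^sub>0)"
    "F \<subseteq> cverts (complete_unfolding d K \<sigma>\<^sub>0 b\<^sub>0) i" "card F = k"
    "A = quot_map (complete_unfolding d K \<sigma>\<^sub>0 b\<^sub>0) i ` geom_simplex F"
    using assms unfolding pfaces_def by blast
  then show thesis
    using that[of "fst i" "snd i" F] by (simp add: complete_unfolding_def)
qed

theorem proposition2p2p2:
  fixes K :: "'a set set" and d :: nat and \<sigma>\<^sub>0 :: "'a set" and b\<^sub>0 :: "'a \<Rightarrow> nat"
  assumes "abs_complex K" and "locally_finite_complex K" and "pure_complex d K"
    and "strongly_connected d K"
    and "\<sigma>\<^sub>0 \<in> facets d K" and "bij_betw b\<^sub>0 \<sigma>\<^sub>0 {0..d}"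
  shows "\<forall>\<Sigma>\<in>pfacets d (complete_unfolding d K \<sigma>\<^sub>0 b\<^sub>0).
           trivial_group (proj_group d (complete_unfolding d K \<sigma>\<^sub>0 b\<^sub>0) \<Sigma>)"
proof
  let ?P = "complete_unfolding d K \<sigma>\<^sub>0 b\<^sub>0"
  note K = assms(1) and b\<^sub>0 = assms(6)
  fix \<Sigma> assume "\<Sigma> \<in> pfacets d ?P"
  then show "trivial_group (proj_group d ?P \<Sigma>)"
  proof (rule trivial_proj_group_if_colored[of d ?P point_color, rotated 2])
    fix T assume "T \<in> pfacets d ?P"
    then obtain \<sigma> b F where cell: "(\<sigma>, b) \<in> unfolding_cells d K \<sigma>\<^sub>0 b\<^sub>0" and F: "F \<subseteq> \<sigma>" "card F = d + 1"
      and T: "T = quot_map ?P (\<sigma>, b) ` geom_simplex F"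
      unfolding pfacets_def by (rule pfaces_complete_unfoldingE)
    have "F = \<sigma>"
      using F unfolding_cell(1,2)[OF K b\<^sub>0 cell] by (simp add: card_subset_eq)
    then show "bij_betw point_color (pverts ?P T) {0..d}"
      using bij_betw_point_color[OF K b\<^sub>0 cell F(1)] unfolding_cell(3)[OF K b\<^sub>0 cell]
      by (simp add: T bij_betw_def)
  next
    fix R assume "R \<in> pridges d ?P"
    then obtain \<sigma> b F where cell: "(\<sigma>, b) \<in> unfolding_cells d K \<sigma>\<^sub>0 b\<^sub>0" and F: "F \<subseteq> \<sigma>" "card F = d"
      and R: "R = quot_map ?P (\<sigma>, b) ` geom_simplex F"
      unfolding pridges_def by (rule pfaces_complete_unfoldingE)
    have "inj_on b F"
      using unfolding_cell(3)[OF K b\<^sub>0 cell] F(1) by (auto simp: bij_betw_def intro: inj_on_subset)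
    then show "card (point_color ` pverts ?P R) = d"
      using bij_betw_point_color[OF K b\<^sub>0 cell F(1)] F(2) by (simp add: R bij_betw_def card_image)
  qed
qed

end
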